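(* Let $f\in\mathbb{C}[x,y]$ be a nonzero binary form of degree $6$ which is stable, i.e. all its roots in $\mathbb{P}^1$ have multiplicity at most $2$. Then $I_4(f)\neq 0$ if and only if $\operatorname{rank} f=4$.
   Context: The Waring rank $\operatorname{rank} f$ of a nonzero binary form $f$ of degree $d$ is the minimal $r$ such that $f=\ell_1^d+\cdots+\ell_r^d$ with $\ell_j\in\mathbb{C}[x,y]$ linear forms. Write a binary sextic as $$f=a_0x^6+6a_1x^5y+15a_2x^4y^2+20a_3x^3y^3+15a_4x^2y^4+6a_5xy^5+a_6y^6 .$$ Then $$I_4(f)=\det\begin{pmatrix} a_0 & a_1 & a_2 & a_3 \\ a_1 & a_2 & a_3 & a_4 \\ a_2 & a_3 & a_4 & a_5 \\ a_3 & a_4 & a_5 & a_6 \end{pmatrix}.$$ *)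

theory Defs
  imports
    "HOL-Computational_Algebra.Computational_Algebra"
    "HOL-Computational_Algebra.Field_as_Ring"
    "Jordan_Normal_Form.Determinant"
begin

text \<open>
  The ring of polynomials in \<open>x, y\<close> over the complex numbers is represented as
  \<^typ>\<open>complex poly poly\<close>: the inner variable is \<open>x\<close> and the outer variable is \<open>y\<close>, so the
  coefficient of \<open>x^i y^j\<close> in \<open>f\<close> is \<open>coeff (coeff f j) i\<close>.
\<close>

definition var_x :: "complex poly poly" where
  "var_x = [:[:0, 1:]:]"

definition var_y :: "complex poly poly" where
  "var_y = [:0, 1:]"

definition const :: "complex \<Rightarrow> complex poly poly" where
  "const c = [:[:c:]:]"

definition eval2 :: "complex poly poly \<Rightarrow> complex \<Rightarrow> complex \<Rightarrow> complex" where
  "eval2 f a b = poly (poly f [:b:]) a"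

text \<open>As usual, the zero polynomial is a form of every degree.\<close>

definition binary_form :: "nat \<Rightarrow> complex poly poly \<Rightarrow> bool" where
  "binary_form d f \<longleftrightarrow> (\<forall>i j. coeff (coeff f j) i \<noteq> 0 \<longrightarrow> i + j = d)"

text \<open>
  The least element is taken over a nonempty set when \<open>f\<close> is a form of degree \<open>d > 0\<close>, because
  the \<open>d\<close>-th powers of linear forms span the forms of degree \<open>d\<close> and all complex scalars are
  \<open>d\<close>-th powers.
\<close>

definition waring_rank :: "nat \<Rightarrow> complex poly poly \<Rightarrow> nat" where
  "waring_rank d f =
    (LEAST r. \<exists>l. (\<forall>j<r. binary_form 1 (l j)) \<and> f = (\<Sum>j<r. l j ^ d))"

text \<open>
  A point \<open>[a : b]\<close> of the projective line is given by homogeneous coordinates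
  \<open>(a, b) \<noteq> (0, 0)\<close>. The linear form vanishing there is \<open>b x - a y\<close>, and the multiplicity of
  the point as a root of \<open>f\<close> is the exponent of that linear form in \<open>f\<close>.
\<close>

definition root_multiplicity :: "complex poly poly \<Rightarrow> complex \<Rightarrow> complex \<Rightarrow> nat" where
  "root_multiplicity f a b = multiplicity (const b * var_x - const a * var_y) f"

definition stable_sextic :: "complex poly poly \<Rightarrow> bool" where
  "stable_sextic f \<longleftrightarrow>
    (\<forall>a b. (a, b) \<noteq> (0, 0) \<and> eval2 f a b = 0 \<longrightarrow> root_multiplicity f a b \<le> 2)"

definition normalized_coeff :: "nat \<Rightarrow> complex poly poly \<Rightarrow> nat \<Rightarrow> complex" where
  "normalized_coeff d f i = coeff (coeff f i) (d - i) / of_nat (d choose i)"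

definition I4 :: "complex poly poly \<Rightarrow> complex" where
  "I4 f = (let a = normalized_coeff 6 f in
    det (mat_of_rows_list 4
      [[a 0, a 1, a 2, a 3],
       [a 1, a 2, a 3, a 4],
       [a 2, a 3, a 4, a 5],
       [a 3, a 4, a 5, a 6]]))"

lemma monomial_eq_monom:
  "const c * var_x ^ i * var_y ^ j = monom (monom c i) j"
proof -
  have c: "const c = monom (monom c 0) 0"
    by (simp add: const_def monom_0)
  have x: "var_x ^ i = monom (monom 1 i) 0"
    by (induction i) (simp_all add: var_x_def monom_0 monom_Suc one_pCons)
  have y: "var_y ^ j = monom 1 j"
    by (simp add: var_y_def monom_altdef)
  show ?thesis
    by (simp add: c x y mult_monom)
qed

lemma binary_form_expansion:
  assumes "binary_form d f"
  shows "f = (\<Sum>i\<le>d. of_nat (d choose i) * const (normalized_coeff d f i)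
    * var_x ^ (d - i) * var_y ^ i)" (is "f = ?g")
proof -
  have c: "of_nat (d choose i) * const (normalized_coeff d f i) * var_x ^ (d - i) * var_y ^ i
      = monom (monom (coeff (coeff f i) (d - i)) (d - i)) i" if "i \<le> d" for i
  proof -
    have "of_nat (d choose i) * const (normalized_coeff d f i) = const (coeff (coeff f i) (d - i))"
      using that by (simp add: const_def normalized_coeff_def of_nat_poly)
    then show ?thesis by (simp add: monomial_eq_monom)
  qed
  have "coeff (coeff f j) k = coeff (coeff ?g j) k" for j k
  proof -
    have "coeff (coeff ?g j) k = (\<Sum>i\<le>d. if i = j \<and> d - i = k then coeff (coeff f i) (d - i) else 0)"
      unfolding coeff_sum by (intro sum.cong refl) (simp add: c)
    also have "\<dots> = (if j \<le> d \<and> d - j = k then coeff (coeff f j) k else 0)"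
    proof -
      have "(\<Sum>i\<le>d. if i = j \<and> d - i = k then coeff (coeff f i) (d - i) else 0)
        = (\<Sum>i\<le>d. if i = j then (if d - j = k then coeff (coeff f j) k else 0) else 0)"
        by (rule sum.cong) auto
      then show ?thesis by simp
    qed
    also have "\<dots> = coeff (coeff f j) k"
      using assms by (force simp: binary_form_def)
    finally show ?thesis ..
  qed
  then show ?thesis by (intro poly_eqI)
qed

end

theory Submission
  imports Defs
begin

text \<open>
  The catalecticant of \<open>l\<^sub>0^6 + \<dots> + l\<^sub>3^6\<close> is \<open>V\<^sup>T V\<close>, where \<open>det V\<close> is the product of the
  pairwise resultants of the \<open>l\<^sub>j\<close>. It vanishes only if two of the \<open>l\<^sub>j\<close> are proportional, and then
  their sixth powers merge into one.

  Conversely, let \<open>L(t^i) = a\<^sub>i\<close>. If the catalecticant is invertible, the monic quartics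
  annihilated by \<open>L\<close> against all quadratics form an affine line \<open>P - s w\<close> with \<open>P\<close> and \<open>w\<close> coprime.
  Since the Wronskian of \<open>P\<close> and \<open>w\<close> has finitely many roots, some member of the line has four
  distinct roots, and Lagrange interpolation there writes \<open>L\<close> as a combination of evaluations.
\<close>

hide_const (open) module.smult

section \<open>Moment functionals and Lagrange interpolation\<close>

text \<open>Write L for this functional, so that L(t^i) = \<open>a i\<close>. As long as degrees
  stay within \<open>N\<close>, the Hankel matrix with entries \<open>a (i + j)\<close> is the Gram
  matrix of (p, q) -> L(p q), and linear systems over it become orthogonality conditions.\<close>

definition moment :: "nat \<Rightarrow> (nat \<Rightarrow> 'a::comm_ring_1) \<Rightarrow> 'a poly \<Rightarrow> 'a" where
  "moment N a p = (\<Sum>i\<le>N. coeff p i * a i)"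

lemma moment_add: "moment N a (p + q) = moment N a p + moment N a q"
  by (simp add: moment_def algebra_simps sum.distrib)

lemma moment_diff: "moment N a (p - q) = moment N a p - moment N a q"
  by (simp add: moment_def algebra_simps sum_subtractf)

lemma moment_smult: "moment N a (smult c p) = c * moment N a p"
  by (simp add: moment_def sum_distrib_left algebra_simps)

lemma moment_sum: "moment N a (\<Sum>x\<in>A. f x) = (\<Sum>x\<in>A. moment N a (f x))"
  unfolding moment_def coeff_sum sum_distrib_right by (rule sum.swap)

lemma moment_monom: "i \<le> N \<Longrightarrow> moment N a (monom c i) = c * a i"
  by (simp add: moment_def if_distrib[of "\<lambda>x. x * _"] cong: if_cong)

lemma moment_mult_eq_0:
  assumes "\<And>i. i < m \<Longrightarrow> moment N a (p * monom 1 i) = 0"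
    and "\<And>i. i \<ge> m \<Longrightarrow> coeff q i = 0"
  shows "moment N a (p * q) = 0"
proof -
  have "p * q = p * (\<Sum>i\<le>degree q. monom (coeff q i) i)"
    by (simp only: poly_as_sum_of_monoms)
  also have "\<dots> = (\<Sum>i\<le>degree q. smult (coeff q i) (p * monom 1 i))"
    by (simp add: sum_distrib_left smult_monom flip: mult_smult_right)
  finally have "moment N a (p * q) = (\<Sum>i\<le>degree q. coeff q i * moment N a (p * monom 1 i))"
    by (simp add: moment_sum moment_smult)
  also have "\<dots> = 0"
    using assms by (intro sum.neutral ballI) (metis mult_zero_left mult_zero_right not_le)
  finally show ?thesis .
qed

text \<open>The weight at \<open>t\<close> is the moment of the Lagrange basis polynomial
  \<open>l t\<close>, which is 1 at \<open>t\<close> and 0 at the other nodes.\<close>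

lemma moment_eq_weighted_sum:
  fixes a :: "nat \<Rightarrow> 'a::field"
  assumes "finite T"
  obtains c where "\<And>p. degree p < card T \<Longrightarrow> moment N a p = (\<Sum>t\<in>T. c t * poly p t)"
proof
  define l where "l t = smult (1 / (\<Prod>s\<in>T - {t}. t - s)) (\<Prod>s\<in>T - {t}. [:- s, 1:])" for t
  have l_same: "poly (l t) t = 1" for t
    using assms by (simp add: l_def poly_prod)
  have l_other: "poly (l t) s = 0" if "s \<in> T" "s \<noteq> t" for s t
    using that assms by (auto simp: l_def poly_prod)
  have deg_l: "degree (l t) < card T" if "t \<in> T" for t
  proof -
    have "degree (l t) \<le> degree (\<Prod>s\<in>T - {t}. [:- s, 1:])"
      by (simp add: l_def)
    also have "\<dots> \<le> (\<Sum>s\<in>T - {t}. degree [:- s, 1:])"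
      by (subst degree_prod_eq_sum_degree) auto
    also have "\<dots> < card T"
      using assms that card_gt_0_iff[of T] by auto
    finally show ?thesis .
  qed
  fix p :: "'a poly"
  assume deg: "degree p < card T"
  have "p = (\<Sum>t\<in>T. smult (poly p t) (l t))"
  proof (rule poly_eqI_degree[where A = T])
    show "poly p x = poly (\<Sum>t\<in>T. smult (poly p t) (l t)) x" if "x \<in> T" for x
    proof -
      have "(\<Sum>t\<in>T. poly p t * poly (l t) x) = (\<Sum>t\<in>T. if t = x then poly p x else 0)"
        using that by (intro sum.cong) (auto simp: l_same l_other)
      then show ?thesis
        using that assms by (simp add: poly_sum)
    qed
    show "degree (\<Sum>t\<in>T. smult (poly p t) (l t)) < card T"
      using deg deg_l by (intro degree_sum_less) (auto intro: le_less_trans[OF degree_smult_le])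
  qed (use deg in auto)
  then have "moment N a p = moment N a (\<Sum>t\<in>T. smult (poly p t) (l t))"
    by simp
  then show "moment N a p = (\<Sum>t\<in>T. moment N a (l t) * poly p t)"
    by (simp add: moment_sum moment_smult mult.commute)
qed

section \<open>Invertible Hankel matrices\<close>

text \<open>If \<open>u\<close> is the coefficient vector of \<open>q\<close>, then row
  \<open>i\<close> of the product of the Hankel matrix with \<open>u\<close> is the moment of q t^i;
  the adjugate supplies the inverse. Exponents k + i with k, i < n never exceed
  \<open>2 * n - 2\<close>, so the truncation in \<open>moment\<close> loses nothing.\<close>

lemma hankel_moment_solve:
  fixes a :: "nat \<Rightarrow> 'a::field"
  assumes "det (mat n n (\<lambda>(i, j). a (i + j))) \<noteq> 0"
  obtains q where "\<And>i. i \<ge> n \<Longrightarrow> coeff q i = 0"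
    and "\<And>i. i < n \<Longrightarrow> moment (2 * n - 2) a (q * monom 1 i) = b i"
proof -
  let ?H = "mat n n (\<lambda>(i, j). a (i + j))"
  have H: "?H \<in> carrier_mat n n"
    by simp
  define u where "u = (1 / det ?H) \<cdot>\<^sub>v (adj_mat ?H *\<^sub>v vec n b)"
  have adj: "adj_mat ?H \<in> carrier_mat n n"
    using adj_mat(1)[OF H] .
  have u: "u \<in> carrier_vec n"
    using adj by (simp add: u_def)
  have "?H *\<^sub>v u = (1 / det ?H) \<cdot>\<^sub>v ((?H * adj_mat ?H) *\<^sub>v vec n b)"
    unfolding u_def using adj by (simp add: mult_mat_vec[OF H] assoc_mult_mat_vec[OF H adj])
  also have "\<dots> = vec n b"
    using assms by (intro eq_vecI) (simp_all add: adj_mat(2)[OF H])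
  finally have Hu: "?H *\<^sub>v u = vec n b" .
  show thesis
  proof
    let ?q = "\<Sum>k<n. monom (u $ k) k"
    show "coeff ?q i = 0" if "i \<ge> n" for i
      using that by (simp add: coeff_sum)
    show "moment (2 * n - 2) a (?q * monom 1 i) = b i" if "i < n" for i
    proof -
      have "moment (2 * n - 2) a (?q * monom 1 i) = (\<Sum>k<n. u $ k * a (k + i))"
        using that by (simp add: sum_distrib_right mult_monom moment_sum moment_monom)
      also have "\<dots> = (?H *\<^sub>v u) $ i"
        using that u by (simp add: scalar_prod_def lessThan_atLeast0 add.commute mult.commute)
      finally show ?thesis
        using that by (simp add: Hu)
    qed
  qed
qed

section \<open>Wronskians and squarefree members of a pencil\<close>

lemma wronskian_neq_0:
  fixes p q :: "'a::field_char_0 poly"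
  assumes "q \<noteq> 0" "degree q < degree p"
  shows "p * pderiv q - pderiv p * q \<noteq> 0"
proof (cases "degree q = 0")
  case True
  then have "pderiv q = 0"
    by (simp add: pderiv_eq_0_iff)
  moreover have "pderiv p \<noteq> 0"
    using assms by (simp add: pderiv_eq_0_iff)
  ultimately show ?thesis
    using assms by simp
next
  case False
  \<comment> \<open>Both products have their leading term in degree \<open>m\<close>, with extra
    factors \<open>degree q\<close> and \<open>degree p\<close>. These differ, so in characteristic
    0 the terms do not cancel.\<close>
  define m where "m = degree q + degree p - 1"
  have "coeff (p * pderiv q) m = lead_coeff p * (of_nat (degree q) * lead_coeff q)"
    using coeff_mult_degree_sum[of p "pderiv q"] False
    by (simp add: m_def degree_pderiv coeff_pderiv add.commute)
  moreover have "coeff (pderiv p * q) m = of_nat (degree p) * lead_coeff p * lead_coeff q"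
    using coeff_mult_degree_sum[of "pderiv p" q] assms
    by (simp add: m_def degree_pderiv coeff_pderiv add.commute)
  ultimately have "coeff (p * pderiv q - pderiv p * q) m
      = (of_nat (degree q) - of_nat (degree p)) * lead_coeff p * lead_coeff q"
    by (simp add: algebra_simps)
  moreover have "p \<noteq> 0"
    using assms by auto
  ultimately have "coeff (p * pderiv q - pderiv p * q) m \<noteq> 0"
    using assms by simp
  then show ?thesis
    by force
qed

text \<open>A multiple root t of p - s q is a root of the Wronskian and satisfies s = p(t) / q(t),
  where q(t) is nonzero because there is no common root. Only finitely many s are therefore
  bad.\<close>

lemma pencil_has_rsquarefree:
  fixes p q :: "complex poly"
  assumes "q \<noteq> 0" "degree q < degree p"
    and "\<And>t. poly p t = 0 \<Longrightarrow> poly q t \<noteq> 0"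
  obtains s where "rsquarefree (p - smult s q)"
proof -
  let ?W = "p * pderiv q - pderiv p * q"
  have "finite ((\<lambda>t. poly p t / poly q t) ` {t. poly ?W t = 0})"
    using wronskian_neq_0[OF assms(1,2)] by (intro finite_imageI poly_roots_finite)
  then obtain s where s: "s \<notin> (\<lambda>t. poly p t / poly q t) ` {t. poly ?W t = 0}"
    using ex_new_if_finite[OF infinite_UNIV_char_0] by blast
  have False if "poly (p - smult s q) t = 0" "poly (pderiv (p - smult s q)) t = 0" for t
  proof -
    have p: "poly p t = s * poly q t" and p': "poly (pderiv p) t = s * poly (pderiv q) t"
      using that by (simp_all add: pderiv_diff pderiv_smult)
    then have "poly ?W t = 0"
      by simp
    moreover have "poly q t \<noteq> 0"
      using p assms(3) by force
    then have "s = poly p t / poly q t"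
      using p by simp
    ultimately show False
      using s by blast
  qed
  then show thesis
    using that rsquarefree_roots by blast
qed

text \<open>A variant of Gaussian quadrature: the nodes are the roots of a monic \<open>G\<close> of
  degree n orthogonal to all degrees below n - 1. Asking for one orthogonality relation fewer than
  in the classical rule leaves the parameter \<open>s\<close> free to make the roots simple, and
  exactness up to degree 2n - 2 remains.\<close>

lemma hankel_decomposition:
  fixes a :: "nat \<Rightarrow> complex"
  assumes "n > 0" and det: "det (mat n n (\<lambda>(i, j). a (i + j))) \<noteq> 0"
  obtains T c where "finite T" "card T = n"
    and "\<And>i. i \<le> 2 * n - 2 \<Longrightarrow> a i = (\<Sum>t\<in>T. c t * t ^ i)"
proof -
  let ?L = "moment (2 * n - 2) a"
  \<comment> \<open>\<open>w\<close> is the direction of the line of candidates; its moment 1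
    against t^(n-1) forces it to be nonzero.\<close>
  obtain w where w: "\<And>i. i \<ge> n \<Longrightarrow> coeff w i = 0"
    and Lw: "\<And>i. i < n \<Longrightarrow> ?L (w * monom 1 i) = (if i = n - 1 then 1 else 0)"
    using hankel_moment_solve[OF det, of "\<lambda>i. if i = n - 1 then 1 else 0"] by metis
  obtain v where v: "\<And>i. i \<ge> n \<Longrightarrow> coeff v i = 0"
    and Lv: "\<And>i. i < n \<Longrightarrow> ?L (v * monom 1 i) = a (n + i)"
    using hankel_moment_solve[OF det, of "\<lambda>i. a (n + i)"] by metis
  define P where "P = monom 1 n - v"
  have coeff_P: "coeff P i = (if i = n then 1 else 0)" if "i \<ge> n" for i
    using that v by (simp add: P_def)
  \<comment> \<open>For i < n - 1 the exponent n + i stays within 2n - 2, so the moment of t^(n+i)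
    is \<open>a (n + i)\<close> and cancels that of v t^i. At i = n - 1 the exponent leaves the
    range.\<close>
  have LP: "?L (P * monom 1 i) = 0" if "i < n - 1" for i
    using that Lv[of i] by (simp add: P_def left_diff_distrib moment_diff mult_monom moment_monom)
  have "w \<noteq> 0"
    using Lw[of "n - 1"] \<open>n > 0\<close> by (auto simp: moment_def)
  have deg_w: "degree w < n"
    using w \<open>w \<noteq> 0\<close> by (metis leading_coeff_0_iff not_le)
  have deg_P: "degree P = n"
    using coeff_P by (intro antisym degree_le le_degree) auto
  \<comment> \<open>At a common root, \<open>P = (X - t) y\<close> and \<open>w = (X - t) z\<close>; then \<open>w y = P z\<close>, whose two sides
    have moments \<open>1\<close> and \<open>0\<close>.\<close>
  have no_common: "poly w t \<noteq> 0" if "poly P t = 0" for t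
  proof
    assume "poly w t = 0"
    then obtain z where z: "w = [:- t, 1:] * z"
      by (auto simp: poly_eq_0_iff_dvd)
    obtain y where y: "P = [:- t, 1:] * y"
      using \<open>poly P t = 0\<close> by (auto simp: poly_eq_0_iff_dvd)
    have "z \<noteq> 0" "y \<noteq> 0"
      using z \<open>w \<noteq> 0\<close> y deg_P \<open>n > 0\<close> by auto
    then have deg_z: "Suc (degree z) < n" and deg_y: "Suc (degree y) = n"
      using deg_w deg_P degree_mult_eq[of "[:- t, 1:]"] by (auto simp: z y simp del: mult_pCons_left)
    have "lead_coeff P = lead_coeff y"
      unfolding y by (simp add: lead_coeff_mult del: mult_pCons_left)
    then have "coeff y (n - 1) = 1"
      using deg_y deg_P coeff_P[of n] by auto
    \<comment> \<open>As \<open>y\<close> is monic of degree n - 1, subtracting t^(n-1) leaves a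
      multiplier of degree below n - 1, which \<open>w\<close> annihilates. So w y has the same
      moment as w t^(n-1).\<close>
    then have "coeff (y - monom 1 (n - 1)) i = 0" if "i \<ge> n - 1" for i
      using that deg_y by (cases "i = n - 1") (auto intro: coeff_eq_0)
    moreover have "?L (w * monom 1 i) = 0" if "i < n - 1" for i
      using that Lw[of i] by simp
    ultimately have "?L (w * (y - monom 1 (n - 1))) = 0"
      by (rule moment_mult_eq_0[where m = "n - 1", rotated])
    then have "?L (w * y) = 1"
      using Lw[of "n - 1"] \<open>n > 0\<close> by (simp add: right_diff_distrib moment_diff)
    moreover have "?L (P * z) = 0"
      using deg_z by (intro moment_mult_eq_0[where m = "n - 1", OF LP] coeff_eq_0) simp_all
    moreover have "w * y = P * z"
      unfolding z y by (simp only: mult_ac)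
    ultimately show False
      by simp
  qed
  obtain s where sqf: "rsquarefree (P - smult s w)"
    using pencil_has_rsquarefree[OF \<open>w \<noteq> 0\<close>] deg_w deg_P no_common by metis
  define G where "G = P - smult s w"
  have coeff_G: "coeff G i = (if i = n then 1 else 0)" if "i \<ge> n" for i
    using that coeff_P w by (simp add: G_def)
  have deg_G: "degree G = n"
    using coeff_G by (intro antisym degree_le le_degree) auto
  have LG: "?L (G * monom 1 i) = 0" if "i < n - 1" for i
    using that LP Lw[of i] by (simp add: G_def left_diff_distrib moment_diff moment_smult)
  define T where "T = {t. poly G t = 0}"
  have "G \<noteq> 0"
    using deg_G \<open>n > 0\<close> by auto
  then have "finite T"
    unfolding T_def by (rule poly_roots_finite)
  \<comment> \<open>A monic squarefree polynomial is the product over its distinct roots; comparing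
    degrees shows that there are n of them.\<close>
  have "G = (\<Prod>t\<in>T. [:- t, 1:])"
    using complex_poly_decompose_rsquarefree[OF sqf] coeff_G[of n] deg_G
    by (simp add: T_def G_def)
  then have "degree G = (\<Sum>t\<in>T. degree [:- t, 1:])"
    using degree_prod_eq_sum_degree[of T "\<lambda>t. [:- t, 1:]"] by auto
  then have card_T: "card T = n"
    using deg_G by simp
  obtain c where c: "\<And>p. degree p < card T \<Longrightarrow> ?L p = (\<Sum>t\<in>T. c t * poly p t)"
    using moment_eq_weighted_sum[OF \<open>finite T\<close>] by metis
  show thesis
  proof (rule that[of T c])
    fix i
    assume i: "i \<le> 2 * n - 2"
    let ?p = "monom 1 i :: complex poly"
    \<comment> \<open>Dividing t^i with i <= 2n - 2 by \<open>G\<close> gives a quotient of degree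
      at most n - 2, which orthogonality kills. The remainder has degree below n, where
      interpolation is exact, and agrees with t^i on the roots of \<open>G\<close>.\<close>
    have "coeff (?p div G) k = 0" if "k \<ge> n - 1" for k
    proof (cases "?p div G = 0")
      case False
      then have "\<not> i < n"
        by (metis div_poly_less deg_G degree_monom_eq one_neq_zero)
      moreover have "degree (?p mod G) < n"
        using degree_mod_less[OF \<open>G \<noteq> 0\<close>, of ?p] \<open>n > 0\<close> deg_G by auto
      ultimately have "degree (?p - ?p mod G) \<le> i"
        by (intro degree_diff_le) (simp_all add: degree_monom_eq)
      moreover have "?p - ?p mod G = G * (?p div G)"
        by (simp add: minus_mod_eq_mult_div)
      ultimately have "n + degree (?p div G) \<le> i"
        using False \<open>G \<noteq> 0\<close> deg_G by (simp add: degree_mult_eq)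
      then show ?thesis
        using that i \<open>n > 0\<close> by (intro coeff_eq_0) linarith
    qed simp
    then have "?L (G * (?p div G)) = 0"
      by (rule moment_mult_eq_0[where m = "n - 1", rotated]) (simp_all add: LG)
    then have "?L ?p = ?L (?p mod G)"
      using moment_add[of "2 * n - 2" a "G * (?p div G)" "?p mod G"] by simp
    also have "\<dots> = (\<Sum>t\<in>T. c t * poly (?p mod G) t)"
      using degree_mod_less[OF \<open>G \<noteq> 0\<close>, of ?p] \<open>n > 0\<close> by (intro c) (auto simp: card_T deg_G)
    also have "\<dots> = (\<Sum>t\<in>T. c t * t ^ i)"
    proof (intro sum.cong refl)
      fix t
      assume "t \<in> T"
      then have "poly (?p mod G) t = poly ?p t"
        using poly_add[of "G * (?p div G)" "?p mod G" t] by (simp add: T_def)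
      then show "c t * poly (?p mod G) t = c t * t ^ i"
        by (simp add: poly_monom)
    qed
    finally show "a i = (\<Sum>t\<in>T. c t * t ^ i)"
      using i by (simp add: moment_monom)
  qed (fact \<open>finite T\<close> card_T)+
qed

section \<open>Waring decompositions\<close>

definition linear_form :: "complex \<Rightarrow> complex \<Rightarrow> complex poly poly" where
  "linear_form p q = const p * var_x + const q * var_y"

lemma linear_form_eq_pCons: "linear_form p q = [:[:0, p:], [:q:]:]"
  by (simp add: linear_form_def const_def var_x_def var_y_def)

lemma const_mult: "const (a * b) = const a * const b"
  by (simp add: const_def)

lemma const_add: "const (a + b) = const a + const b"
  by (simp add: const_def)

lemma const_sum: "const (\<Sum>x\<in>A. g x) = (\<Sum>x\<in>A. const (g x))"
  by (induction A rule: infinite_finite_induct) (simp_all add: const_add, simp_all add: const_def)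

lemma const_power: "const (a ^ n) = const a ^ n"
  by (induction n) (simp_all add: const_mult, simp add: const_def one_pCons)

lemma linear_form_power:
  "linear_form p q ^ d = (\<Sum>i\<le>d. of_nat (d choose i) * const (p ^ (d - i) * q ^ i)
    * var_x ^ (d - i) * var_y ^ i)"
proof -
  have "linear_form p q ^ d = (const q * var_y + const p * var_x) ^ d"
    by (simp add: linear_form_def add.commute)
  also have "\<dots> = (\<Sum>i\<le>d. of_nat (d choose i) * (const q * var_y) ^ i * (const p * var_x) ^ (d - i))"
    by (rule binomial_ring)
  finally show ?thesis
    by (simp add: const_mult const_power power_mult_distrib mult_ac)
qed

lemma sum_linear_form_powers:
  "(\<Sum>j\<in>A. linear_form (p j) (q j) ^ d) = (\<Sum>i\<le>d. of_nat (d choose i)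
    * const (\<Sum>j\<in>A. p j ^ (d - i) * q j ^ i) * var_x ^ (d - i) * var_y ^ i)"
  unfolding linear_form_power const_sum sum_distrib_left sum_distrib_right by (rule sum.swap)

lemma normalized_coeff_expansion:
  assumes "i \<le> d"
  shows "normalized_coeff d (\<Sum>k\<le>d. of_nat (d choose k) * const (b k)
    * var_x ^ (d - k) * var_y ^ k) i = b i"
proof -
  have "of_nat (d choose k) * const (b k) * var_x ^ (d - k) * var_y ^ k
      = monom (monom (of_nat (d choose k) * b k) (d - k)) k" for k
  proof -
    have "of_nat (d choose k) * const (b k) = const (of_nat (d choose k) * b k)"
      by (simp add: const_def of_nat_poly)
    then show ?thesis
      by (simp add: monomial_eq_monom)
  qed
  then have "coeff (\<Sum>k\<le>d. of_nat (d choose k) * const (b k) * var_x ^ (d - k) * var_y ^ k) i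
      = (\<Sum>k\<le>d. if k = i then monom (of_nat (d choose i) * b i) (d - i) else 0)"
    unfolding coeff_sum by (intro sum.cong) auto
  then show ?thesis
    using assms by (simp add: normalized_coeff_def)
qed

text \<open>The normalization of the coefficients cancels the binomial factors in the expansion of a
  d-th power, so a Waring decomposition becomes a system of power-sum equations.\<close>

lemma eq_sum_linear_form_powers_iff:
  assumes "binary_form d f"
  shows "f = (\<Sum>j\<in>A. linear_form (p j) (q j) ^ d)
    \<longleftrightarrow> (\<forall>i\<le>d. normalized_coeff d f i = (\<Sum>j\<in>A. p j ^ (d - i) * q j ^ i))"
proof
  assume "f = (\<Sum>j\<in>A. linear_form (p j) (q j) ^ d)"
  then show "\<forall>i\<le>d. normalized_coeff d f i = (\<Sum>j\<in>A. p j ^ (d - i) * q j ^ i)"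
    by (simp add: sum_linear_form_powers normalized_coeff_expansion)
next
  assume *: "\<forall>i\<le>d. normalized_coeff d f i = (\<Sum>j\<in>A. p j ^ (d - i) * q j ^ i)"
  show "f = (\<Sum>j\<in>A. linear_form (p j) (q j) ^ d)"
    unfolding sum_linear_form_powers
    by (subst binary_form_expansion[OF assms]) (intro sum.cong, auto simp: *)
qed

text \<open>A d-th root r of the weight absorbs it: c (x + t y)^d = (r x + r t y)^d.\<close>

lemma decomposition_of_weighted_powers:
  assumes "binary_form d f" "d > 0"
    and "\<And>i. i \<le> d \<Longrightarrow> normalized_coeff d f i = (\<Sum>t\<in>T. c t * t ^ i)"
  obtains p q where "f = (\<Sum>t\<in>T. linear_form (p t) (q t) ^ d)"
proof -
  have "\<forall>t. \<exists>r. r ^ d = c t"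
    using nth_root_exists[OF \<open>d > 0\<close>] by blast
  then obtain r where r: "\<And>t. r t ^ d = c t"
    by metis
  have "r t ^ (d - i) * (r t * t) ^ i = c t * t ^ i" if "i \<le> d" for t i
    using that r[of t] by (simp add: power_mult_distrib flip: power_add)
  then show thesis
    using that[of r "\<lambda>t. r t * t"] assms(3)
    by (simp add: eq_sum_linear_form_powers_iff[OF assms(1)])
qed

lemma binary_form_1_iff: "binary_form 1 l \<longleftrightarrow> (\<exists>p q. l = linear_form p q)"
proof
  assume "binary_form 1 l"
  from binary_form_expansion[OF this]
  have "l = linear_form (normalized_coeff 1 l 0) (normalized_coeff 1 l 1)"
    by (simp add: linear_form_def)
  then show "\<exists>p q. l = linear_form p q"
    by blast
next
  assume "\<exists>p q. l = linear_form p q"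
  then show "binary_form 1 l"
    by (auto simp: binary_form_def linear_form_eq_pCons coeff_pCons split: nat.splits)
qed

section \<open>The Waring rank as an attained minimum\<close>

lemma waring_rank_eq_Least:
  "waring_rank d f = (LEAST r. \<exists>p q. f = (\<Sum>j<r. linear_form (p j) (q j) ^ d))"
proof -
  have "(\<exists>l. (\<forall>j<r. binary_form 1 (l j)) \<and> f = (\<Sum>j<r. l j ^ d))
      \<longleftrightarrow> (\<exists>p q. f = (\<Sum>j<r. linear_form (p j) (q j) ^ d))" for r
  proof
    assume "\<exists>l. (\<forall>j<r. binary_form 1 (l j)) \<and> f = (\<Sum>j<r. l j ^ d)"
    then obtain l where "\<forall>j<r. \<exists>p q. l j = linear_form p q" and f: "f = (\<Sum>j<r. l j ^ d)"
      unfolding binary_form_1_iff by blast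
    then obtain p q where "\<And>j. j < r \<Longrightarrow> l j = linear_form (p j) (q j)"
      by metis
    then show "\<exists>p q. f = (\<Sum>j<r. linear_form (p j) (q j) ^ d)"
      using f by auto
  next
    assume "\<exists>p q. f = (\<Sum>j<r. linear_form (p j) (q j) ^ d)"
    then obtain p q where f: "f = (\<Sum>j<r. linear_form (p j) (q j) ^ d)"
      by blast
    show "\<exists>l. (\<forall>j<r. binary_form 1 (l j)) \<and> f = (\<Sum>j<r. l j ^ d)"
    proof (intro exI[of _ "\<lambda>j. linear_form (p j) (q j)"] conjI)
      show "\<forall>j<r. binary_form 1 (linear_form (p j) (q j))"
        unfolding binary_form_1_iff by blast
    qed (fact f)
  qed
  then show ?thesis
    unfolding waring_rank_def by (intro arg_cong[of _ _ Least] ext)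
qed

lemma waring_rank_le_card:
  assumes "finite A" "f = (\<Sum>j\<in>A. linear_form (p j) (q j) ^ d)"
  shows "waring_rank d f \<le> card A"
proof -
  obtain h where h: "bij_betw h {..<card A} A"
    using ex_bij_betw_nat_finite[OF assms(1)] by (auto simp: lessThan_atLeast0)
  have "f = (\<Sum>j<card A. linear_form (p (h j)) (q (h j)) ^ d)"
    unfolding assms(2) by (rule sum.reindex_bij_betw[OF h, symmetric])
  then have "\<exists>p q. f = (\<Sum>j<card A. linear_form (p j) (q j) ^ d)"
    by (intro exI)
  then show ?thesis
    unfolding waring_rank_eq_Least by (rule Least_le)
qed

text \<open>The \<open>LEAST\<close> is attained once some decomposition exists. Interpolation at
  the d + 1 distinct nodes 0, ..., d is exact up to degree d and provides one.\<close>

lemma waring_rank_decomposition: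
  assumes "binary_form d f" "d > 0"
  shows "\<exists>p q. f = (\<Sum>j<waring_rank d f. linear_form (p j) (q j) ^ d)"
proof -
  let ?T = "of_nat ` {..d} :: complex set"
  have card_T: "card ?T = d + 1"
    by (subst card_image) (auto intro: inj_onI)
  obtain c where c: "\<And>g. degree g < card ?T
      \<Longrightarrow> moment d (normalized_coeff d f) g = (\<Sum>t\<in>?T. c t * poly g t)"
    by (rule moment_eq_weighted_sum[of ?T d "normalized_coeff d f",
          OF finite_imageI[OF finite_atMost]]) blast
  have "normalized_coeff d f i = (\<Sum>t\<in>?T. c t * t ^ i)" if "i \<le> d" for i
  proof -
    have "degree (monom 1 i :: complex poly) < card ?T"
      using that by (simp add: card_T degree_monom_eq)
    from c[OF this] show ?thesis
      using that by (simp add: moment_monom poly_monom)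
  qed
  then obtain p q where f: "f = (\<Sum>t\<in>?T. linear_form (p t) (q t) ^ d)"
    by (rule decomposition_of_weighted_powers[OF assms])
  have "f = (\<Sum>j<Suc d. linear_form (p (of_nat j)) (q (of_nat j)) ^ d)"
    unfolding f by (subst sum.reindex) (auto simp: lessThan_Suc_atMost intro: inj_onI)
  then have "\<exists>p q. f = (\<Sum>j<Suc d. linear_form (p j) (q j) ^ d)"
    by (intro exI)
  then show ?thesis
    unfolding waring_rank_eq_Least
    by (rule LeastI[where P = "\<lambda>r. \<exists>p q. f = (\<Sum>j<r. linear_form (p j) (q j) ^ d)"])
qed

text \<open>If the first form l is nonzero, the second is c l, with c read off from a nonzero
  coordinate of l. The sum is (1 + c^d) l^d, and a d-th root of 1 + c^d, possibly 0, is moved into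
  the form.\<close>

lemma linear_form_powers_merge:
  assumes "p * q' = p' * q" "d > 0"
  obtains r s where "linear_form p q ^ d + linear_form p' q' ^ d = linear_form r s ^ d"
proof (cases "p = 0 \<and> q = 0")
  case True
  then show ?thesis
    using that[of p' q'] \<open>d > 0\<close> by (simp add: linear_form_eq_pCons)
next
  case False
  define c where "c = (if p = 0 then q' / q else p' / p)"
  have c: "p' = c * p" "q' = c * q"
    using False assms(1) by (auto simp: c_def field_simps)
  obtain e where e: "e ^ d = 1 + c ^ d"
    using nth_root_exists[OF \<open>d > 0\<close>] by blast
  have scale: "linear_form (b * p) (b * q) = const b * linear_form p q" for b
    by (simp add: linear_form_def const_mult algebra_simps)
  have "linear_form p q ^ d + linear_form p' q' ^ d = (1 + const (c ^ d)) * linear_form p q ^ d"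
    by (simp add: c scale const_power power_mult_distrib algebra_simps)
  also have "\<dots> = linear_form (e * p) (e * q) ^ d"
  proof -
    have "1 + const (c ^ d) = const (e ^ d)"
      by (simp add: e const_def one_pCons)
    then show ?thesis
      by (simp add: scale const_power power_mult_distrib)
  qed
  finally show ?thesis
    using that by blast
qed

section \<open>The catalecticant of a sum of sixth powers\<close>

text \<open>Laplace expansion along row 0. Each minor is again a \<open>mat\<close> with a shifted
  index function, so rewriting can iterate the expansion.\<close>

lemma det_mat_Suc:
  fixes g :: "nat \<times> nat \<Rightarrow> 'a::comm_ring_1"
  shows "det (mat (Suc n) (Suc n) g) = (\<Sum>j<Suc n. g (0, j) * ((- 1) ^ j
    * det (mat n n (\<lambda>(i, k). g (Suc i, if k < j then k else Suc k)))))"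
proof -
  have "mat_delete (mat (Suc n) (Suc n) g) 0 j
      = mat n n (\<lambda>(i, k). g (Suc i, if k < j then k else Suc k))" if "j < Suc n" for j
    using that by (intro eq_matI) (auto simp: mat_delete_def)
  then show ?thesis
    by (subst laplace_expansion_row[of _ "Suc n" 0])
      (auto simp: cofactor_def simp del: sum.lessThan_Suc intro!: sum.cong)
qed

lemma det_mat_3:
  fixes g :: "nat \<times> nat \<Rightarrow> 'a::comm_ring_1"
  shows "det (mat 3 3 g) =
     g (0,0) * (g (1,1) * g (2,2) - g (1,2) * g (2,1))
   - g (0,1) * (g (1,0) * g (2,2) - g (1,2) * g (2,0))
   + g (0,2) * (g (1,0) * g (2,1) - g (1,1) * g (2,0))"
  by (simp add: numeral_eq_Suc det_mat_Suc algebra_simps)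

lemma det_mat_4:
  fixes g :: "nat \<times> nat \<Rightarrow> 'a::comm_ring_1"
  shows "det (mat 4 4 g) =
      g (0,0) * det (mat 3 3 (\<lambda>(i, k). g (Suc i, Suc k)))
    - g (0,1) * det (mat 3 3 (\<lambda>(i, k). g (Suc i, if k < 1 then k else Suc k)))
    + g (0,2) * det (mat 3 3 (\<lambda>(i, k). g (Suc i, if k < 2 then k else Suc k)))
    - g (0,3) * det (mat 3 3 (\<lambda>(i, k). g (Suc i, k)))"
proof -
  have "mat 3 3 (\<lambda>(i, k). g (Suc i, if k < 3 then k else Suc k)) = mat 3 3 (\<lambda>(i, k). g (Suc i, k))"
    by (intro eq_matI) auto
  then show ?thesis
    using det_mat_Suc[of 3 g] by (simp add: eval_nat_numeral)
qed


text \<open>The homogeneous Vandermonde determinant: setting every \<open>p j\<close> to 1 gives the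
  usual product of differences.\<close>

lemma det_binary_cubes:
  fixes p q :: "nat \<Rightarrow> 'a::comm_ring_1"
  shows "det (mat 4 4 (\<lambda>(j, i). p j ^ (3 - i) * q j ^ i)) =
    (p 0 * q 1 - p 1 * q 0) * (p 0 * q 2 - p 2 * q 0) * (p 0 * q 3 - p 3 * q 0) *
    (p 1 * q 2 - p 2 * q 1) * (p 1 * q 3 - p 3 * q 1) * (p 2 * q 3 - p 3 * q 2)"
proof -
  \<comment> \<open>Naming the entries keeps the terms small, which makes the ring normalization feasible.\<close>
  obtain p0 p1 p2 p3 q0 q1 q2 q3 where
    "p 0 = p0" "p (Suc 0) = p1" "p (Suc (Suc 0)) = p2" "p (Suc (Suc (Suc 0))) = p3"
    "q 0 = q0" "q (Suc 0) = q1" "q (Suc (Suc 0)) = q2" "q (Suc (Suc (Suc 0))) = q3"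
    by simp
  then show ?thesis
    by (simp add: det_mat_4 det_mat_3)
      (simp add: numeral_2_eq_2 numeral_3_eq_3, simp add: algebra_simps)
qed

lemma I4_eq_det_hankel:
  "I4 f = det (mat 4 4 (\<lambda>(i, j). normalized_coeff 6 f (i + j)))"
  unfolding I4_def Let_def mat_of_rows_list_def
  by (intro arg_cong[of _ _ det] eq_matI) (auto simp: less_Suc_eq numeral_eq_Suc)

lemma I4_sum_of_four_powers:
  assumes "binary_form 6 f" "f = (\<Sum>j<4. linear_form (p j) (q j) ^ 6)"
  shows "I4 f = (det (mat 4 4 (\<lambda>(j, i). p j ^ (3 - i) * q j ^ i)))\<^sup>2"
proof -
  let ?V = "mat 4 4 (\<lambda>(j, i). p j ^ (3 - i) * q j ^ i)"
  have V: "?V \<in> carrier_mat 4 4"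
    by simp
  have a: "normalized_coeff 6 f i = (\<Sum>j<4. p j ^ (6 - i) * q j ^ i)" if "i \<le> 6" for i
    using eq_sum_linear_form_powers_iff[OF assms(1)] assms(2) that by blast
  have "mat 4 4 (\<lambda>(i, j). normalized_coeff 6 f (i + j)) = ?V\<^sup>T * ?V"
  proof (intro eq_matI)
    fix i k
    assume "i < dim_row (?V\<^sup>T * ?V)" "k < dim_col (?V\<^sup>T * ?V)"
    then have "i < 4" "k < 4"
      by auto
    \<comment> \<open>Since i, k <= 3, no subtraction truncates, and the exponent splits into one
      factor for each copy of the matrix.\<close>
    moreover have "p j ^ (6 - (i + k)) = p j ^ (3 - i) * p j ^ (3 - k)" for j
      using \<open>i < 4\<close> \<open>k < 4\<close> by (simp flip: power_add)
    ultimately show "mat 4 4 (\<lambda>(i, j). normalized_coeff 6 f (i + j)) $$ (i, k)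
        = (?V\<^sup>T * ?V) $$ (i, k)"
      by (simp add: a scalar_prod_def lessThan_atLeast0 power_add mult_ac)
  qed auto
  then show ?thesis
    using det_mult[of "?V\<^sup>T" 4 ?V] det_transpose[OF V]
    by (simp add: I4_eq_det_hankel power2_eq_square)
qed

section \<open>Rank against vanishing of the catalecticant\<close>

lemma I4_eq_0_if_waring_rank_lt_4:
  assumes "binary_form 6 f" "waring_rank 6 f < 4"
  shows "I4 f = 0"
proof -
  let ?r = "waring_rank 6 f"
  obtain p q where f: "f = (\<Sum>j<?r. linear_form (p j) (q j) ^ 6)"
    using waring_rank_decomposition[OF assms(1) zero_less_numeral] by blast
  \<comment> \<open>Padding with zero forms gives four summands without changing the sum; the last
    one is zero, so its resultants with the others vanish.\<close>
  define p' q' where "p' j = (if j < ?r then p j else 0)" and "q' j = (if j < ?r then q j else 0)" for j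
  have f': "f = (\<Sum>j<4. linear_form (p' j) (q' j) ^ 6)"
    by (subst f, rule sum.mono_neutral_cong_left)
      (use assms(2) in \<open>auto simp: p'_def q'_def linear_form_eq_pCons\<close>)
  have "p' 3 = 0" "q' 3 = 0"
    using assms(2) by (auto simp: p'_def q'_def)
  then show ?thesis
    by (simp add: I4_sum_of_four_powers[OF assms(1) f'] det_binary_cubes)
qed

lemma I4_neq_0_if_waring_rank_eq_4:
  assumes "binary_form 6 f" "waring_rank 6 f = 4"
  shows "I4 f \<noteq> 0"
proof
  assume "I4 f = 0"
  obtain p q where f: "f = (\<Sum>j<(4::nat). linear_form (p j) (q j) ^ 6)"
    using waring_rank_decomposition[OF assms(1) zero_less_numeral] unfolding assms(2) by blast
  have "\<exists>j<4. \<exists>k<4. j \<noteq> k \<and> p j * q k = p k * q j"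
  proof (rule ccontr)
    assume "\<not> ?thesis"
    then have "p j * q k \<noteq> p k * q j" if "j < 4" "k < 4" "j \<noteq> k" for j k
      using that by blast
    then show False
      using \<open>I4 f = 0\<close> by (simp add: I4_sum_of_four_powers[OF assms(1) f] det_binary_cubes)
  qed
  then obtain j k where jk: "j < 4" "k < 4" "j \<noteq> k" and "p j * q k = p k * q j"
    by blast
  then obtain r s where merge:
    "linear_form (p j) (q j) ^ 6 + linear_form (p k) (q k) ^ 6 = linear_form r s ^ 6"
    using linear_form_powers_merge[of "p j" "q k" "p k" "q j" 6] by auto
  have A: "{..<4} = insert j (insert k ({..<4} - {j, k}))"
    using jk by auto
  have "f = linear_form (p j) (q j) ^ 6 + (linear_form (p k) (q k) ^ 6
      + (\<Sum>i\<in>{..<4} - {j, k}. linear_form (p i) (q i) ^ 6))"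
    unfolding f by (subst A, use jk in simp)
  also have "\<dots> = linear_form r s ^ 6 + (\<Sum>i\<in>{..<4} - {j, k}. linear_form (p i) (q i) ^ 6)"
    by (simp add: merge flip: add.assoc)
  \<comment> \<open>The merged form takes index \<open>j\<close> and index \<open>k\<close> is
    dropped, leaving a decomposition over three indices.\<close>
  also have "\<dots> = (\<Sum>i\<in>insert j ({..<4} - {j, k}).
      linear_form ((p(j := r)) i) ((q(j := s)) i) ^ 6)"
    by (subst sum.insert) (auto intro!: sum.cong arg_cong2[of _ _ _ _ "(+)"])
  also have "insert j ({..<4} - {j, k}) = {..<4} - {k}"
    using jk by auto
  finally have "waring_rank 6 f \<le> card ({..<4} - {k})"
    using waring_rank_le_card[of "{..<4} - {k}"] by blast
  then show False
    using assms(2) jk by simp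
qed

text \<open>With n = 4 the quadrature is exact up to degree 2n - 2 = 6, which covers precisely the
  coefficients of a sextic.\<close>

lemma waring_rank_le_4_if_I4_neq_0:
  assumes "binary_form 6 f" "I4 f \<noteq> 0"
  shows "waring_rank 6 f \<le> 4"
proof -
  obtain T c where T: "finite T" "card T = 4"
    and a: "\<And>i. i \<le> 6 \<Longrightarrow> normalized_coeff 6 f i = (\<Sum>t\<in>T. c t * t ^ i)"
    using hankel_decomposition[of 4 "normalized_coeff 6 f"] assms(2)
    by (auto simp: I4_eq_det_hankel)
  obtain p q where "f = (\<Sum>t\<in>T. linear_form (p t) (q t) ^ 6)"
    by (rule decomposition_of_weighted_powers[OF assms(1) zero_less_numeral a])
  from waring_rank_le_card[OF T(1) this] show ?thesis
    by (simp add: T(2))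
qed

theorem proposition4p5:
  fixes f :: "complex poly poly"
  assumes "binary_form 6 f"
    and "f \<noteq> 0"
    and "stable_sextic f"
  shows "I4 f \<noteq> 0 \<longleftrightarrow> waring_rank 6 f = 4"
  using I4_eq_0_if_waring_rank_lt_4[OF assms(1)] I4_neq_0_if_waring_rank_eq_4[OF assms(1)]
    waring_rank_le_4_if_I4_neq_0[OF assms(1)]
  by linarith

end
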